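(* Let $A$ be a weakly noetherian $B_1$-algebra. Then each associated prime ideal of $A$ is of the form $Ann_A(u)$ for some $u\in A\setminus\{0\}$; in particular, it is saturated.
   Context: A $B_1$-algebra (characteristic one semiring) is a commutative semiring $A$ with $0$ (neutral for addition and absorbing for multiplication) and $1$, such that $1+1=1$ (hence $x+x=x$ for all $x\in A$). An ideal of $A$ is a subset containing $0$, closed under addition, and closed under multiplication by elements of $A$. The saturation of an ideal $I$ is $\overline{I}=\{x\in A\mid \exists y\in I,\ x+y=y\}$, which is an ideal; $I$ is saturated if $I=\overline{I}$. An ideal $\mathcal{P}$ is prime if $\mathcal{P}\neq A$ and $xy\in\mathcal{P}$ implies $x\in\mathcal{P}$ or $y\in\mathcal{P}$. A minimal prime ideal is a minimal element, for inclusion, of the set of all prime ideals. $A$ is weakly noetherian if every ascending chain of saturated ideals of $A$ is ultimately stationary. For $s\in A$, $Ann_A(s)=\{x\in A\mid sx=0\}$, which is a saturated ideal. For an ideal $I$, $\mathcal{R}_I$ is the congruence on $A$ given by $x\,\mathcal{R}_I\,y$ iff there is $z\in I$ with $x+z=y+z$. For $x\in A\setminus\{0\}$, let $\tilde{A}_x=A/\mathcal{R}_{Ann_A(x)}$ (the quotient $B_1$-algebra) and let $\pi_x:A\to\tilde{A}_x$ be the canonical projection. An ideal $\mathcal{P}$ of $A$ is associated to $x\in A\setminus\{0\}$ if $\mathcal{P}=\pi_x^{-1}(\mathcal{Q})$ for some minimal prime ideal $\mathcal{Q}$ of $\tilde{A}_x$; it is associated if it is associated to some $x\in A\setminus\{0\}$.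 (Every associated ideal is prime.) *)

theory Defs
  imports "HOL-Algebra.Ring"
begin

text \<open>The trivial algebra \<open>\<one> = \<zero>\<close> is admitted.\<close>

locale b1_algebra = semiring A + comm_monoid A for A (structure) +
  assumes one_add_one: "\<one> \<oplus> \<one> = \<one>"

text \<open>The library's \<open>ideal\<close> locale presupposes a ring, so ideals are defined afresh.\<close>

definition b1_ideal :: "('a, 'm) ring_scheme \<Rightarrow> 'a set \<Rightarrow> bool" where
  "b1_ideal A I \<longleftrightarrow> I \<subseteq> carrier A \<and> \<zero>\<^bsub>A\<^esub> \<in> I \<and>
     (\<forall>x\<in>I. \<forall>y\<in>I. x \<oplus>\<^bsub>A\<^esub> y \<in> I) \<and>
     (\<forall>a\<in>carrier A. \<forall>x\<in>I. a \<otimes>\<^bsub>A\<^esub> x \<in> I)"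

definition saturation :: "('a, 'm) ring_scheme \<Rightarrow> 'a set \<Rightarrow> 'a set" where
  "saturation A I = {x \<in> carrier A. \<exists>y\<in>I. x \<oplus>\<^bsub>A\<^esub> y = y}"

definition saturated_ideal :: "('a, 'm) ring_scheme \<Rightarrow> 'a set \<Rightarrow> bool" where
  "saturated_ideal A I \<longleftrightarrow> b1_ideal A I \<and> I = saturation A I"

definition prime_b1_ideal :: "('a, 'm) ring_scheme \<Rightarrow> 'a set \<Rightarrow> bool" where
  "prime_b1_ideal A P \<longleftrightarrow> b1_ideal A P \<and> P \<noteq> carrier A \<and>
     (\<forall>x\<in>carrier A. \<forall>y\<in>carrier A. x \<otimes>\<^bsub>A\<^esub> y \<in> P \<longrightarrow> x \<in> P \<or> y \<in> P)"

definition minimal_prime_b1_ideal :: "('a, 'm) ring_scheme \<Rightarrow> 'a set \<Rightarrow> bool" where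
  "minimal_prime_b1_ideal A P \<longleftrightarrow> prime_b1_ideal A P \<and>
     (\<forall>Q. prime_b1_ideal A Q \<and> Q \<subseteq> P \<longrightarrow> Q = P)"

definition weakly_noetherian :: "('a, 'm) ring_scheme \<Rightarrow> bool" where
  "weakly_noetherian A \<longleftrightarrow>
     (\<forall>I :: nat \<Rightarrow> 'a set. (\<forall>n. saturated_ideal A (I n)) \<and> (\<forall>n. I n \<subseteq> I (Suc n)) \<longrightarrow>
        (\<exists>N. \<forall>n\<ge>N. I n = I N))"

definition Ann :: "('a, 'm) ring_scheme \<Rightarrow> 'a \<Rightarrow> 'a set" where
  "Ann A s = {x \<in> carrier A. s \<otimes>\<^bsub>A\<^esub> x = \<zero>\<^bsub>A\<^esub>}"

definition ideal_cong :: "('a, 'm) ring_scheme \<Rightarrow> 'a set \<Rightarrow> ('a \<times> 'a) set" where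
  "ideal_cong A I =
     {(x, y) \<in> carrier A \<times> carrier A. \<exists>z\<in>I. x \<oplus>\<^bsub>A\<^esub> z = y \<oplus>\<^bsub>A\<^esub> z}"

text \<open>The unions over representatives are the usual encoding of operations on
  equivalence classes; see \<open>quot_mult\<close> and \<open>quot_add\<close> below.\<close>

definition cong_quot :: "('a, 'm) ring_scheme \<Rightarrow> ('a \<times> 'a) set \<Rightarrow> 'a set ring" where
  "cong_quot A R =
     \<lparr>carrier = carrier A // R,
      mult = (\<lambda>X Y. \<Union>x\<in>X. \<Union>y\<in>Y. R `` {x \<otimes>\<^bsub>A\<^esub> y}),
      one = R `` {\<one>\<^bsub>A\<^esub>},
      zero = R `` {\<zero>\<^bsub>A\<^esub>},
      add = (\<lambda>X Y. \<Union>x\<in>X. \<Union>y\<in>Y. R `` {x \<oplus>\<^bsub>A\<^esub> y})\<rparr>"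

definition ann_quot :: "('a, 'm) ring_scheme \<Rightarrow> 'a \<Rightarrow> 'a set ring" where
  "ann_quot A x = cong_quot A (ideal_cong A (Ann A x))"

definition ann_proj :: "('a, 'm) ring_scheme \<Rightarrow> 'a \<Rightarrow> 'a \<Rightarrow> 'a set" where
  "ann_proj A x a = ideal_cong A (Ann A x) `` {a}"

definition associated_to :: "('a, 'm) ring_scheme \<Rightarrow> 'a \<Rightarrow> 'a set \<Rightarrow> bool" where
  "associated_to A x P \<longleftrightarrow>
     (\<exists>Q. minimal_prime_b1_ideal (ann_quot A x) Q \<and> P = {a \<in> carrier A. ann_proj A x a \<in> Q})"

definition associated_ideal :: "('a, 'm) ring_scheme \<Rightarrow> 'a set \<Rightarrow> bool" where
  "associated_ideal A P \<longleftrightarrow> (\<exists>x\<in>carrier A - {\<zero>\<^bsub>A\<^esub>}. associated_to A x P)"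


context b1_algebra
begin

lemma add_idem: "x \<in> carrier A \<Longrightarrow> x \<oplus> x = x"
  using l_distr[of \<one> \<one> x] by (simp add: one_add_one)

lemma Ann_saturated:
  assumes s: "s \<in> carrier A"
  shows "saturated_ideal A (Ann A s)"
proof -
  have *: "s \<otimes> (a \<otimes> x) = \<zero>" if "a \<in> carrier A" "x \<in> carrier A" "s \<otimes> x = \<zero>" for a x
    using m_lcomm[of s a x] s that by simp
  have **: "s \<otimes> x = \<zero>"
    if "x \<in> carrier A" "y \<in> carrier A" "s \<otimes> y = \<zero>" "x \<oplus> y = y" for x y
    using r_distr[of x y s] s that by simp
  have "b1_ideal A (Ann A s)"
    unfolding b1_ideal_def Ann_def using s by (simp add: r_distr *)
  moreover have "Ann A s \<subseteq> saturation A (Ann A s)"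
    unfolding saturation_def Ann_def using add_idem by blast
  moreover have "saturation A (Ann A s) \<subseteq> Ann A s"
    unfolding saturation_def Ann_def using ** by blast
  ultimately show ?thesis
    unfolding saturated_ideal_def by blast
qed

lemma equiv_ideal_cong:
  assumes I: "b1_ideal A I"
  shows "equiv (carrier A) (ideal_cong A I)"
proof (rule equivI)
  show "ideal_cong A I \<subseteq> carrier A \<times> carrier A"
    by (auto simp: ideal_cong_def)
  show "refl_on (carrier A) (ideal_cong A I)"
    using I by (auto simp: ideal_cong_def refl_on_def b1_ideal_def)
  show "sym (ideal_cong A I)"
    unfolding ideal_cong_def by (rule symI) (simp add: eq_commute)
  show "trans (ideal_cong A I)"
  proof (rule transI)
    fix x y z assume "(x, y) \<in> ideal_cong A I" "(y, z) \<in> ideal_cong A I"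
    then obtain u v where c: "x \<in> carrier A" "y \<in> carrier A" "z \<in> carrier A"
      and u: "u \<in> I" "x \<oplus> u = y \<oplus> u" and v: "v \<in> I" "y \<oplus> v = z \<oplus> v"
      by (auto simp: ideal_cong_def)
    have uv: "u \<in> carrier A" "v \<in> carrier A" "u \<oplus> v \<in> I"
      using I u v by (auto simp: b1_ideal_def)
    have "x \<oplus> (u \<oplus> v) = (y \<oplus> u) \<oplus> v" using c uv u by (simp flip: a_assoc)
    also have "\<dots> = (y \<oplus> v) \<oplus> u" using c uv by (simp add: a_ac)
    also have "\<dots> = z \<oplus> (u \<oplus> v)" using c uv v by (simp add: a_ac)
    finally show "(x, z) \<in> ideal_cong A I" using c uv by (auto simp: ideal_cong_def)
  qed
qed

lemma mult_respects:
  assumes I: "b1_ideal A I"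
  shows "(\<lambda>x y. ideal_cong A I `` {x \<otimes> y}) respects2 ideal_cong A I"
proof -
  have key: "(w \<otimes> y, w \<otimes> z) \<in> ideal_cong A I"
    if "(y, z) \<in> ideal_cong A I" "w \<in> carrier A" for w y z
  proof -
    from that obtain u where c: "y \<in> carrier A" "z \<in> carrier A"
      and u: "u \<in> I" "y \<oplus> u = z \<oplus> u" by (auto simp: ideal_cong_def)
    then have "u \<in> carrier A" "w \<otimes> u \<in> I" using I that by (auto simp: b1_ideal_def)
    moreover from this have "w \<otimes> y \<oplus> w \<otimes> u = w \<otimes> z \<oplus> w \<otimes> u"
      using c u that by (metis r_distr)
    ultimately show ?thesis using c that by (auto simp: ideal_cong_def)
  qed
  have car: "y \<in> carrier A" "z \<in> carrier A" if "(y, z) \<in> ideal_cong A I" for y z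
    using that by (auto simp: ideal_cong_def)
  show ?thesis
  proof (rule congruent2_commuteI[OF equiv_ideal_cong[OF I]])
    fix y z assume "y \<in> carrier A" "z \<in> carrier A"
    then show "ideal_cong A I `` {y \<otimes> z} = ideal_cong A I `` {z \<otimes> y}"
      by (simp add: m_comm)
  next
    fix y z w assume "w \<in> carrier A" "(y, z) \<in> ideal_cong A I"
    then show "ideal_cong A I `` {w \<otimes> y} = ideal_cong A I `` {w \<otimes> z}"
      by (intro equiv_class_eq[OF equiv_ideal_cong[OF I]] key)
  qed
qed

lemma add_respects:
  assumes I: "b1_ideal A I"
  shows "(\<lambda>x y. ideal_cong A I `` {x \<oplus> y}) respects2 ideal_cong A I"
proof -
  have key: "(w \<oplus> y, w \<oplus> z) \<in> ideal_cong A I"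
    if "(y, z) \<in> ideal_cong A I" "w \<in> carrier A" for w y z
  proof -
    from that obtain u where c: "y \<in> carrier A" "z \<in> carrier A"
      and u: "u \<in> I" "y \<oplus> u = z \<oplus> u" by (auto simp: ideal_cong_def)
    then have "u \<in> carrier A" using I that by (auto simp: b1_ideal_def)
    moreover from this have "(w \<oplus> y) \<oplus> u = (w \<oplus> z) \<oplus> u"
      using c u that by (metis a_assoc)
    ultimately show ?thesis using c u that by (auto simp: ideal_cong_def)
  qed
  show ?thesis
  proof (rule congruent2_commuteI[OF equiv_ideal_cong[OF I]])
    fix y z assume "y \<in> carrier A" "z \<in> carrier A"
    then show "ideal_cong A I `` {y \<oplus> z} = ideal_cong A I `` {z \<oplus> y}"
      by (simp add: a_comm)
  next
    fix y z w assume "w \<in> carrier A" "(y, z) \<in> ideal_cong A I"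
    then show "ideal_cong A I `` {w \<oplus> y} = ideal_cong A I `` {w \<oplus> z}"
      by (intro equiv_class_eq[OF equiv_ideal_cong[OF I]] key)
  qed
qed

lemma quot_mult:
  assumes "b1_ideal A I" "a \<in> carrier A" "b \<in> carrier A"
  shows "ideal_cong A I `` {a} \<otimes>\<^bsub>cong_quot A (ideal_cong A I)\<^esub> ideal_cong A I `` {b}
       = ideal_cong A I `` {a \<otimes> b}"
  using UN_equiv_class2[OF equiv_ideal_cong equiv_ideal_cong mult_respects] assms
  by (simp add: cong_quot_def)

lemma quot_add:
  assumes "b1_ideal A I" "a \<in> carrier A" "b \<in> carrier A"
  shows "ideal_cong A I `` {a} \<oplus>\<^bsub>cong_quot A (ideal_cong A I)\<^esub> ideal_cong A I `` {b}
       = ideal_cong A I `` {a \<oplus> b}"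
  using UN_equiv_class2[OF equiv_ideal_cong equiv_ideal_cong add_respects] assms
  by (simp add: cong_quot_def)

lemma quot_carrier: "carrier (cong_quot A R) = (\<lambda>a. R `` {a}) ` carrier A"
  by (auto simp: cong_quot_def quotient_def)

lemma quot_b1_algebra:
  assumes I: "b1_ideal A I"
  shows "b1_algebra (cong_quot A (ideal_cong A I))"
proof -
  let ?Q = "cong_quot A (ideal_cong A I)" and ?p = "\<lambda>a. ideal_cong A I `` {a}"
  have z: "\<zero>\<^bsub>?Q\<^esub> = ?p \<zero>" and o: "\<one>\<^bsub>?Q\<^esub> = ?p \<one>" by (auto simp: cong_quot_def)
  note simps = z o quot_carrier quot_mult[OF I] quot_add[OF I]
  show ?thesis
  proof (intro b1_algebra.intro semiring.intro abelian_monoid.intro semiring_axioms.intro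
      b1_algebra_axioms.intro)
    show "comm_monoid (add_monoid ?Q)"
      by (rule comm_monoidI) (auto simp: simps a_ac)
    show "monoid ?Q"
      by (rule monoidI) (auto simp: simps m_assoc)
    show "comm_monoid ?Q"
      by (rule comm_monoidI) (auto simp: simps m_ac)
  qed (auto simp: simps l_distr r_distr one_add_one)
qed

lemma associated_ideal_prime:
  assumes "associated_ideal A P"
  shows "prime_b1_ideal A P"
proof -
  obtain x Q where x: "x \<in> carrier A"
    and Q: "prime_b1_ideal (ann_quot A x) Q" and P: "P = {a \<in> carrier A. ann_proj A x a \<in> Q}"
    using assms by (auto simp: associated_ideal_def associated_to_def minimal_prime_b1_ideal_def)
  have I: "b1_ideal A (Ann A x)" using Ann_saturated[OF x] by (simp add: saturated_ideal_def)
  let ?Q = "cong_quot A (ideal_cong A (Ann A x))" and ?p = "\<lambda>a. ideal_cong A (Ann A x) `` {a}"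
  have z: "\<zero>\<^bsub>?Q\<^esub> = ?p \<zero>" by (auto simp: cong_quot_def)
  have Q': "b1_ideal ?Q Q" "Q \<noteq> carrier ?Q"
    and prime: "\<And>X Y. \<lbrakk>X \<in> carrier ?Q; Y \<in> carrier ?Q; X \<otimes>\<^bsub>?Q\<^esub> Y \<in> Q\<rbrakk> \<Longrightarrow> X \<in> Q \<or> Y \<in> Q"
    using Q by (auto simp: prime_b1_ideal_def ann_quot_def)
  have p: "?p a \<in> carrier ?Q" if "a \<in> carrier A" for a
    using that by (auto simp: quot_carrier)
  have mem: "a \<in> P \<longleftrightarrow> a \<in> carrier A \<and> ?p a \<in> Q" for a
    by (auto simp: P ann_proj_def)
  have add: "X \<oplus>\<^bsub>?Q\<^esub> Y \<in> Q" if "X \<in> Q" "Y \<in> Q" for X Y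
    using that Q'(1) unfolding b1_ideal_def by blast
  have mult: "X \<otimes>\<^bsub>?Q\<^esub> Y \<in> Q" if "X \<in> carrier ?Q" "Y \<in> Q" for X Y
    using that Q'(1) unfolding b1_ideal_def by blast
  have "a \<oplus> b \<in> P" if "a \<in> P" "b \<in> P" for a b
    using that add[of "?p a" "?p b"] by (simp add: mem quot_add[OF I])
  moreover have "a \<otimes> b \<in> P" if "a \<in> carrier A" "b \<in> P" for a b
    using that mult[OF p, of a "?p b"] by (simp add: mem quot_mult[OF I])
  moreover have "\<zero> \<in> P"
    using Q'(1) unfolding mem b1_ideal_def z by auto
  ultimately have "b1_ideal A P"
    unfolding b1_ideal_def by (auto simp: mem)
  moreover have "P \<noteq> carrier A"
  proof
    assume "P = carrier A"
    then have "carrier ?Q \<subseteq> Q" unfolding quot_carrier using mem by blast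
    then show False using Q' unfolding b1_ideal_def by blast
  qed
  moreover have "a \<in> P \<or> b \<in> P" if "a \<in> carrier A" "b \<in> carrier A" "a \<otimes> b \<in> P" for a b
  proof -
    have "?p a \<otimes>\<^bsub>?Q\<^esub> ?p b \<in> Q"
      using that quot_mult[OF I, of a b] unfolding mem by simp
    then show ?thesis using prime[OF p p] that unfolding mem by blast
  qed
  ultimately show ?thesis unfolding prime_b1_ideal_def by blast
qed

end

end

theory Submission
  imports Defs
begin

text \<open>For \<open>a\<close> in a minimal prime there are \<open>s\<close> outside the prime and \<open>n\<close> with \<open>s a\<^sup>n = \<zero>\<close>:
  otherwise some prime would avoid the monoid of all such \<open>s a\<^sup>n\<close>, and so be strictly smaller. For \<open>P\<close>
  associated to \<open>x\<close> this yields, for every \<open>a \<in> P\<close>, some \<open>s \<notin> P\<close> with \<open>x s a\<^sup>n = \<zero>\<close>.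
  Annihilators are saturated, so among the multiples \<open>y\<close> of \<open>x\<close> with \<open>Ann y \<subseteq> P\<close> there is one
  whose annihilator is maximal. Then \<open>Ann (y c) = Ann y\<close> for all \<open>c \<notin> P\<close>, so \<open>y a\<^sup>n = \<zero>\<close>; and if
  \<open>y a \<noteq> \<zero>\<close>, the last nonzero \<open>y a\<^sup>n\<close> has a strictly larger annihilator, still inside \<open>P\<close>. So
  \<open>P = Ann y\<close>.\<close>

section \<open>Maximal members of families of saturated ideals\<close>

text \<open>Without a maximal member, dependent choice builds a strictly increasing sequence in
  \<open>F\<close>, which the chain condition forbids.\<close>

lemma weakly_noetherian_maximal:
  assumes wn: "weakly_noetherian A"
    and sat: "\<And>I. I \<in> F \<Longrightarrow> saturated_ideal A I"
    and ne: "F \<noteq> {}"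
  shows "\<exists>I\<in>F. \<forall>J\<in>F. I \<subseteq> J \<longrightarrow> J = I"
proof (rule ccontr)
  assume "\<not> ?thesis"
  then have step: "\<exists>J. J \<in> F \<and> I \<subset> J" if "I \<in> F" for I
    using that by blast
  have "\<exists>f. \<forall>n. f n \<in> F \<and> f n \<subset> f (Suc n)"
    by (rule dependent_nat_choice) (use ne step in auto)
  then obtain f where f: "\<And>n. f n \<in> F" "\<And>n. f n \<subset> f (Suc n)" by blast
  then obtain N where N: "\<And>n. n \<ge> N \<Longrightarrow> f n = f N"
    using wn sat unfolding weakly_noetherian_def by (metis psubset_imp_subset)
  have "f (Suc N) = f N" by (rule N) simp
  then show False using f(2)[of N] by simp
qed

context b1_algebra
begin

section \<open>Primes avoiding a multiplicative set, and minimal primes\<close>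

lemma b1_ideal_add_principal:
  assumes I: "b1_ideal A I" and x: "x \<in> carrier A"
  shows "b1_ideal A {i \<oplus> a \<otimes> x |i a. i \<in> I \<and> a \<in> carrier A}" (is "b1_ideal A ?K")
    and "I \<subseteq> {i \<oplus> a \<otimes> x |i a. i \<in> I \<and> a \<in> carrier A}"
    and "x \<in> {i \<oplus> a \<otimes> x |i a. i \<in> I \<and> a \<in> carrier A}"
proof -
  have Ic: "i \<in> carrier A" if "i \<in> I" for i using I that by (auto simp: b1_ideal_def)
  have Iz: "\<zero> \<in> I" using I by (auto simp: b1_ideal_def)
  show sub: "I \<subseteq> ?K"
  proof
    fix i assume i: "i \<in> I"
    then have "i = i \<oplus> \<zero> \<otimes> x" using x Ic by simp
    then show "i \<in> ?K" using i by blast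
  qed
  have "x = \<zero> \<oplus> \<one> \<otimes> x" using x by simp
  then show "x \<in> ?K" using Iz by blast
  have "u \<oplus> v \<in> ?K" if uv: "u \<in> ?K" "v \<in> ?K" for u v
  proof -
    from uv obtain i a j b where c: "i \<in> I" "j \<in> I" "a \<in> carrier A" "b \<in> carrier A"
      and "u = i \<oplus> a \<otimes> x" "v = j \<oplus> b \<otimes> x" by blast
    then have "u \<oplus> v = (i \<oplus> j) \<oplus> (a \<oplus> b) \<otimes> x"
      using x Ic by (simp add: l_distr a_ac)
    moreover have "i \<oplus> j \<in> I" using c I by (auto simp: b1_ideal_def)
    ultimately show ?thesis using c by blast
  qed
  moreover have "b \<otimes> u \<in> ?K" if "b \<in> carrier A" "u \<in> ?K" for b u
  proof -
    from that obtain i a where c: "i \<in> I" "a \<in> carrier A" and "u = i \<oplus> a \<otimes> x" by blast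
    then have "b \<otimes> u = b \<otimes> i \<oplus> (b \<otimes> a) \<otimes> x"
      using x Ic that by (simp add: r_distr m_assoc)
    moreover have "b \<otimes> i \<in> I" using c that I by (auto simp: b1_ideal_def)
    ultimately show ?thesis using c that by blast
  qed
  moreover have "?K \<subseteq> carrier A" using Ic x by auto
  moreover have "\<zero> \<in> ?K" using sub Iz by (rule subsetD)
  ultimately show "b1_ideal A ?K"
    unfolding b1_ideal_def by (intro conjI ballI)
qed

text \<open>Krull's argument: if neither \<open>x\<close> nor \<open>y\<close> lies in
  \<open>I\<close>, the ideals obtained by adjoining \<open>x\<close> or \<open>y\<close> to
  \<open>I\<close> both meet \<open>S\<close>. The product of an element of \<open>S\<close> from
  each lies in \<open>S\<close>, and it would lie in \<open>I\<close> as well if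
  \<open>x \<otimes> y\<close> did.\<close>

lemma maximal_avoiding_ideal_prime:
  assumes S: "S \<subseteq> carrier A" "\<one> \<in> S" "\<And>s t. s \<in> S \<Longrightarrow> t \<in> S \<Longrightarrow> s \<otimes> t \<in> S"
    and I: "b1_ideal A I" "I \<inter> S = {}"
    and max: "\<And>K. b1_ideal A K \<Longrightarrow> K \<inter> S = {} \<Longrightarrow> I \<subseteq> K \<Longrightarrow> K = I"
  shows "prime_b1_ideal A I"
proof -
  have Ic: "i \<in> carrier A" if "i \<in> I" for i using I that by (auto simp: b1_ideal_def)
  have Im: "a \<otimes> i \<in> I" if "a \<in> carrier A" "i \<in> I" for a i
    using I that by (auto simp: b1_ideal_def)
  have Ia: "i \<oplus> j \<in> I" if "i \<in> I" "j \<in> I" for i j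
    using I that by (auto simp: b1_ideal_def)
  have meet: "\<exists>i a. i \<in> I \<and> a \<in> carrier A \<and> i \<oplus> a \<otimes> x \<in> S"
    if x: "x \<in> carrier A" "x \<notin> I" for x
    using max[OF b1_ideal_add_principal(1)[OF I(1) x(1)]]
      b1_ideal_add_principal(2,3)[OF I(1) x(1)] x(2) by blast
  have "x \<in> I \<or> y \<in> I" if c: "x \<in> carrier A" "y \<in> carrier A" and xy: "x \<otimes> y \<in> I" for x y
  proof (rule ccontr)
    assume "\<not> ?thesis"
    then obtain i a j b where ij: "i \<in> I" "j \<in> I" and ab: "a \<in> carrier A" "b \<in> carrier A"
      and s: "i \<oplus> a \<otimes> x \<in> S" and t: "j \<oplus> b \<otimes> y \<in> S"
      using meet c by metis
    \<comment> \<open>The product is regrouped so that each of the three summands has a factor in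
      \<open>I\<close>: \<open>i\<close>, \<open>j\<close> or \<open>x \<otimes> y\<close>.\<close>
    have "(i \<oplus> a \<otimes> x) \<otimes> (j \<oplus> b \<otimes> y)
        = (j \<oplus> b \<otimes> y) \<otimes> i \<oplus> ((a \<otimes> x) \<otimes> j \<oplus> (a \<otimes> b) \<otimes> (x \<otimes> y))"
      using c ab ij[THEN Ic] by (simp add: l_distr r_distr m_ac a_ac)
    also have "\<dots> \<in> I"
    proof (intro Ia)
      show "(j \<oplus> b \<otimes> y) \<otimes> i \<in> I" "(a \<otimes> x) \<otimes> j \<in> I" using c ab ij Ic by (auto intro!: Im)
      show "(a \<otimes> b) \<otimes> (x \<otimes> y) \<in> I" by (rule Im[OF _ xy]) (use ab in simp)
    qed
    finally show False using S(3)[OF s t] I(2) by blast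
  qed
  moreover have "I \<noteq> carrier A" using S I by auto
  ultimately show ?thesis using I unfolding prime_b1_ideal_def by blast
qed

text \<open>Zorn's lemma on the ideals avoiding \<open>S\<close>, a family that contains
  \<open>{\<zero>}\<close> because \<open>\<zero> \<notin> S\<close>; a maximal member is prime by
  the preceding lemma.\<close>

lemma ex_prime_avoiding:
  assumes S: "S \<subseteq> carrier A" "\<one> \<in> S" "\<And>s t. s \<in> S \<Longrightarrow> t \<in> S \<Longrightarrow> s \<otimes> t \<in> S"
    and zero: "\<zero> \<notin> S"
  shows "\<exists>P. prime_b1_ideal A P \<and> P \<inter> S = {}"
proof -
  let ?F = "{I. b1_ideal A I \<and> I \<inter> S = {}}"
  have "b1_ideal A {\<zero>}" by (auto simp: b1_ideal_def)
  then have "{\<zero>} \<in> ?F" using zero by auto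
  moreover have "\<Union>C \<in> ?F" if C: "C \<noteq> {}" "subset.chain ?F C" for C
  proof -
    have id: "b1_ideal A I" "I \<inter> S = {}" if "I \<in> C" for I
      using C that unfolding subset.chain_def by auto
    have "x \<oplus> y \<in> \<Union>C" if "x \<in> \<Union>C" "y \<in> \<Union>C" for x y
    proof -
      from that obtain I J where IJ: "I \<in> C" "J \<in> C" "x \<in> I" "y \<in> J" by blast
      then have "I \<subseteq> J \<or> J \<subseteq> I" using C unfolding subset.chain_def by blast
      then obtain K where "K \<in> C" "x \<in> K" "y \<in> K" using IJ by blast
      then show ?thesis using id[of K] unfolding b1_ideal_def by blast
    qed
    moreover have "\<Union>C \<subseteq> carrier A" "\<zero> \<in> \<Union>C"
      using id C unfolding b1_ideal_def by blast+
    moreover have "a \<otimes> x \<in> \<Union>C" if "a \<in> carrier A" "x \<in> \<Union>C" for a x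
      using that id unfolding b1_ideal_def by blast
    ultimately have "b1_ideal A (\<Union>C)" unfolding b1_ideal_def by blast
    then show ?thesis using id by blast
  qed
  ultimately obtain M where "M \<in> ?F" "\<forall>K\<in>?F. M \<subseteq> K \<longrightarrow> K = M"
    using subset_Zorn_nonempty[of ?F] by auto
  then show ?thesis
    using maximal_avoiding_ideal_prime[OF S, of M] by blast
qed

lemma minimal_prime_annihilated:
  assumes min: "minimal_prime_b1_ideal A Q" and a: "a \<in> Q"
  shows "\<exists>s\<in>carrier A - Q. \<exists>n::nat. s \<otimes> a [^] n = \<zero>"
proof (rule ccontr)
  assume neg: "\<not> ?thesis"
  have Q: "b1_ideal A Q" "Q \<noteq> carrier A"
    and prime: "\<And>x y. x \<in> carrier A \<Longrightarrow> y \<in> carrier A \<Longrightarrow> x \<otimes> y \<in> Q \<Longrightarrow> x \<in> Q \<or> y \<in> Q"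
    using min by (auto simp: minimal_prime_b1_ideal_def prime_b1_ideal_def)
  have ac: "a \<in> carrier A" and Qc: "Q \<subseteq> carrier A" using Q a by (auto simp: b1_ideal_def)
  have one: "\<one> \<notin> Q"
  proof
    assume "\<one> \<in> Q"
    then have "b \<in> Q" if "b \<in> carrier A" for b
      using Q(1) that unfolding b1_ideal_def by (metis r_one)
    then show False using Q Qc by blast
  qed
  \<comment> \<open>Taking \<open>n = 0\<close> puts the complement of \<open>Q\<close> into this
    set, and \<open>s = \<one>\<close>, \<open>n = 1\<close> puts \<open>a\<close> there. It is
    closed under products because \<open>Q\<close> is prime, and it omits \<open>\<zero>\<close> by
    the negated goal.\<close>
  let ?S = "{s \<otimes> a [^] n |s n. s \<in> carrier A - Q \<and> (n::nat) \<in> UNIV}"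
  have inS: "s \<in> ?S" if "s \<in> carrier A - Q" for s
  proof -
    have "s = s \<otimes> a [^] (0::nat)" using that by simp
    then show ?thesis using that by blast
  qed
  have aS: "a \<in> ?S"
  proof -
    have "a = \<one> \<otimes> a [^] (1::nat)" using ac by simp
    then show ?thesis using one by blast
  qed
  have "u \<otimes> v \<in> ?S" if uv: "u \<in> ?S" "v \<in> ?S" for u v
  proof -
    from uv obtain s t and m n :: nat where st: "s \<in> carrier A - Q" "t \<in> carrier A - Q"
      and "u = s \<otimes> a [^] m" "v = t \<otimes> a [^] n" by blast
    then have "u \<otimes> v = (s \<otimes> t) \<otimes> a [^] (m + n)"
      using ac by (simp add: nat_pow_mult[symmetric] m_ac)
    moreover have "s \<otimes> t \<in> carrier A - Q" using st prime by auto
    ultimately show ?thesis by blast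
  qed
  moreover have "?S \<subseteq> carrier A" using ac by auto
  moreover have "\<zero> \<notin> ?S" using neg by fastforce
  ultimately obtain P where P: "prime_b1_ideal A P" "P \<inter> ?S = {}"
    using ex_prime_avoiding[of ?S] inS[of \<one>] one by auto
  have "P \<subseteq> carrier A" using P(1) by (simp add: prime_b1_ideal_def b1_ideal_def)
  \<comment> \<open>Since \<open>P\<close> avoids the complement of \<open>Q\<close>, it lies in
    \<open>Q\<close>. Minimality then forces equality, although \<open>a\<close> is in
    \<open>Q\<close> and not in \<open>P\<close>.\<close>
  then have "P \<subseteq> Q" using P(2) inS by (meson DiffI disjoint_iff subset_iff)
  then have "P = Q" using min P(1) unfolding minimal_prime_b1_ideal_def by blast
  then show False using a aS P(2) by blast
qed

section \<open>Transfer between the algebra and its quotient by an annihilator\<close>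

text \<open>This rests on saturation: \<open>a\<close> is congruent to \<open>\<zero>\<close> iff
  \<open>a \<oplus> z = z\<close> for some \<open>z\<close> in \<open>Ann A x\<close>, which puts
  \<open>a\<close> into the saturation of \<open>Ann A x\<close>, that is, into
  \<open>Ann A x\<close> itself.\<close>

lemma zero_class_iff:
  assumes x: "x \<in> carrier A" and a: "a \<in> carrier A"
  shows "ann_proj A x a = ann_proj A x \<zero> \<longleftrightarrow> x \<otimes> a = \<zero>"
proof -
  have I: "b1_ideal A (Ann A x)" and sat: "Ann A x = saturation A (Ann A x)"
    using Ann_saturated[OF x] by (auto simp: saturated_ideal_def)
  have "ann_proj A x a = ann_proj A x \<zero> \<longleftrightarrow> (a, \<zero>) \<in> ideal_cong A (Ann A x)"
    unfolding ann_proj_def using eq_equiv_class_iff[OF equiv_ideal_cong[OF I] a] by simp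
  also have "\<dots> \<longleftrightarrow> (\<exists>z\<in>Ann A x. a \<oplus> z = z)"
    using a by (auto simp: ideal_cong_def Ann_def)
  also have "\<dots> \<longleftrightarrow> a \<in> saturation A (Ann A x)" using a by (simp add: saturation_def)
  also have "\<dots> \<longleftrightarrow> x \<otimes> a = \<zero>" unfolding sat[symmetric] using a by (simp add: Ann_def)
  finally show ?thesis .
qed

lemma ann_proj_mult:
  assumes x: "x \<in> carrier A" and ab: "a \<in> carrier A" "b \<in> carrier A"
  shows "ann_proj A x a \<otimes>\<^bsub>ann_quot A x\<^esub> ann_proj A x b = ann_proj A x (a \<otimes> b)"
  using Ann_saturated[OF x] ab
  by (simp add: ann_proj_def ann_quot_def quot_mult saturated_ideal_def)

lemma ann_proj_pow:
  assumes x: "x \<in> carrier A" and a: "a \<in> carrier A"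
  shows "ann_proj A x a [^]\<^bsub>ann_quot A x\<^esub> (n::nat) = ann_proj A x (a [^] n)"
proof (induction n)
  case 0
  then show ?case by (simp add: ann_quot_def ann_proj_def cong_quot_def nat_pow_def)
next
  case (Suc n)
  then show ?case using ann_proj_mult[OF x nat_pow_closed[OF a] a, of n]
    by (simp add: nat_pow_def)
qed

text \<open>The result on minimal primes is applied in the quotient and pulled back along
  representatives: a product equal to the zero class there is a product killed by \<open>x\<close>
  in \<open>A\<close>.\<close>

lemma associated_to_annihilated:
  assumes x: "x \<in> carrier A" and P: "associated_to A x P"
  shows "Ann A x \<subseteq> P"
    and "a \<in> P \<Longrightarrow> \<exists>s\<in>carrier A - P. \<exists>n::nat. x \<otimes> (s \<otimes> a [^] n) = \<zero>"
proof -
  let ?B = "ann_quot A x" and ?p = "ann_proj A x"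
  obtain Q where Q: "minimal_prime_b1_ideal ?B Q" and Pdef: "P = {a \<in> carrier A. ?p a \<in> Q}"
    using P by (auto simp: associated_to_def)
  have zero: "\<zero>\<^bsub>?B\<^esub> = ?p \<zero>" by (simp add: ann_quot_def ann_proj_def cong_quot_def)
  have "?p \<zero> \<in> Q"
    using Q unfolding zero[symmetric] minimal_prime_b1_ideal_def prime_b1_ideal_def b1_ideal_def
    by blast
  then have "b \<in> P" if "b \<in> Ann A x" for b
    using that zero_class_iff[OF x, of b] by (simp add: Pdef Ann_def)
  then show "Ann A x \<subseteq> P" by blast
  interpret B: b1_algebra ?B
    using Ann_saturated[OF x] quot_b1_algebra by (simp add: ann_quot_def saturated_ideal_def)
  assume "a \<in> P"
  then have a: "a \<in> carrier A" "?p a \<in> Q" by (auto simp: Pdef)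
  obtain t and n :: nat where t: "t \<in> carrier ?B - Q" and tn: "t \<otimes>\<^bsub>?B\<^esub> ?p a [^]\<^bsub>?B\<^esub> n = ?p \<zero>"
    using B.minimal_prime_annihilated[OF Q a(2)] zero by auto
  obtain s where s: "s \<in> carrier A" "t = ?p s"
    using t by (auto simp: ann_quot_def quot_carrier ann_proj_def)
  have "?p (s \<otimes> a [^] n) = ?p \<zero>"
    using tn s a x by (simp add: ann_proj_pow ann_proj_mult)
  then have "x \<otimes> (s \<otimes> a [^] n) = \<zero>" using zero_class_iff[OF x] s a by simp
  moreover have "s \<in> carrier A - P" using s t by (simp add: Pdef)
  ultimately show "\<exists>s\<in>carrier A - P. \<exists>n::nat. x \<otimes> (s \<otimes> a [^] n) = \<zero>" by blast
qed

section \<open>Maximal annihilators inside a prime\<close>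

lemma prime_eq_Ann:
  assumes wn: "weakly_noetherian A" and P: "prime_b1_ideal A P" and x: "x \<in> carrier A"
    and sub: "Ann A x \<subseteq> P"
    and ann: "\<And>a. a \<in> P \<Longrightarrow> \<exists>s\<in>carrier A - P. \<exists>n::nat. x \<otimes> (s \<otimes> a [^] n) = \<zero>"
  shows "\<exists>u\<in>carrier A. P = Ann A u"
proof -
  \<comment> \<open>Restricting to multiples of \<open>x\<close> lets the relations provided by
    \<open>ann\<close> carry over to the chosen \<open>y\<close>.\<close>
  let ?Y = "{x \<otimes> r |r. r \<in> carrier A \<and> Ann A (x \<otimes> r) \<subseteq> P}"
  have Pc: "P \<subseteq> carrier A" using P by (auto simp: prime_b1_ideal_def b1_ideal_def)
  have "x \<otimes> \<one> \<in> ?Y" by (intro CollectI exI[of _ \<one>] conjI refl) (use sub x in auto)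
  then have "Ann A ` ?Y \<noteq> {}" by blast
  moreover have "saturated_ideal A I" if "I \<in> Ann A ` ?Y" for I
    using that x by (auto intro: Ann_saturated)
  ultimately obtain y where y: "y \<in> ?Y"
    and max: "\<And>z. z \<in> ?Y \<Longrightarrow> Ann A y \<subseteq> Ann A z \<Longrightarrow> Ann A z = Ann A y"
    using weakly_noetherian_maximal[OF wn, of "Ann A ` ?Y"] by auto
  from y obtain r where r: "r \<in> carrier A" "y = x \<otimes> r" by blast
  have yc: "y \<in> carrier A" and yP: "Ann A y \<subseteq> P" using y x by auto
  \<comment> \<open>Multiplying by \<open>c\<close> can only enlarge the annihilator, so maximality
    leaves it unchanged as long as it stays inside \<open>P\<close>.\<close>
  have mult: "Ann A (y \<otimes> c) = Ann A y" if c: "c \<in> carrier A" "Ann A (y \<otimes> c) \<subseteq> P" for c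
  proof (rule max)
    have "y \<otimes> c = x \<otimes> (r \<otimes> c)" using r c x by (simp add: m_assoc)
    then show "y \<otimes> c \<in> ?Y" using r c by auto
    have "y \<otimes> c \<otimes> b = c \<otimes> (y \<otimes> b)" if "b \<in> carrier A" for b
      using yc c that by (simp add: m_ac)
    then show "Ann A y \<subseteq> Ann A (y \<otimes> c)" using c by (auto simp: Ann_def)
  qed
  \<comment> \<open>Primality supplies the bound that \<open>mult\<close> requires: if
    \<open>b\<close> kills \<open>y \<otimes> c\<close>, then \<open>c \<otimes> b\<close> lies in
    \<open>Ann A y \<subseteq> P\<close> with \<open>c\<close> outside \<open>P\<close>, so
    \<open>b\<close> is in \<open>P\<close>.\<close>
  have outside: "Ann A (y \<otimes> c) = Ann A y" if c: "c \<in> carrier A - P" for c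
  proof (rule mult)
    show "Ann A (y \<otimes> c) \<subseteq> P"
    proof
      fix b assume "b \<in> Ann A (y \<otimes> c)"
      then have b: "b \<in> carrier A" "c \<otimes> b \<in> Ann A y"
        using yc c by (auto simp: Ann_def m_assoc)
      then show "b \<in> P" using yP P c unfolding prime_b1_ideal_def by blast
    qed
  qed (use c in simp)
  \<comment> \<open>Used twice below: to drop \<open>s\<close> from
    \<open>y \<otimes> (s \<otimes> a [^] n) = \<zero>\<close>, and to bound the annihilator of
    \<open>y \<otimes> a [^] Suc m\<close>.\<close>
  have cancel: "y \<otimes> b = \<zero>" if "c \<in> carrier A - P" "b \<in> carrier A" "y \<otimes> (c \<otimes> b) = \<zero>" for b c
  proof -
    have "b \<in> Ann A (y \<otimes> c)" using that yc by (simp add: Ann_def m_assoc)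
    then have "b \<in> Ann A y" using outside that(1) by blast
    then show ?thesis by (simp add: Ann_def)
  qed
  have "P \<subseteq> Ann A y"
  proof
    fix a assume a: "a \<in> P"
    then have ac: "a \<in> carrier A" using Pc by auto
    obtain s and n :: nat where s: "s \<in> carrier A - P" and n: "x \<otimes> (s \<otimes> a [^] n) = \<zero>"
      using ann[OF a] by blast
    have "y \<otimes> (s \<otimes> a [^] n) = r \<otimes> (x \<otimes> (s \<otimes> a [^] n))"
      using x r s ac by (simp add: m_ac)
    then have "y \<otimes> (s \<otimes> a [^] n) = \<zero>" using n r by simp
    then have "y \<otimes> a [^] n = \<zero>" using cancel s ac by simp
    moreover have "y \<otimes> a = \<zero>" if "y \<otimes> a [^] Suc m = \<zero>" for m
    proof -
      show ?thesis using that
      proof (induction m)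
        case (Suc m)
        show ?case
        proof (cases "y \<otimes> a [^] Suc m = \<zero>")
          \<comment> \<open>Now \<open>a\<close> kills the nonzero element
            \<open>y \<otimes> a [^] Suc m\<close>. Anything outside \<open>P\<close> killing it
            would make it zero by \<open>cancel\<close>, so its annihilator lies in \<open>P\<close>
            and equals \<open>Ann A y\<close> by \<open>mult\<close>; hence \<open>a\<close> kills
            \<open>y\<close>.\<close>
          case False
          let ?b = "a [^] Suc m"
          have bc: "?b \<in> carrier A" using ac by blast
          have "Ann A (y \<otimes> ?b) \<subseteq> P"
          proof
            fix c assume "c \<in> Ann A (y \<otimes> ?b)"
            then have c: "c \<in> carrier A" "y \<otimes> ?b \<otimes> c = \<zero>" by (auto simp: Ann_def)
            then have "y \<otimes> (c \<otimes> ?b) = \<zero>" using yc bc by (metis m_assoc m_comm)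
            then show "c \<in> P" using cancel[of c ?b] c bc False by blast
          qed
          then have "Ann A (y \<otimes> ?b) = Ann A y" using mult bc by blast
          moreover have "y \<otimes> ?b \<otimes> a = \<zero>"
            using Suc.prems yc bc ac by (simp only: nat_pow_Suc m_assoc m_closed)
          ultimately show ?thesis using ac by (auto simp: Ann_def)
        qed (rule Suc.IH)
      qed (use ac in simp)
    qed
    \<comment> \<open>This covers the exponent \<open>n = 0\<close>, where
      \<open>y \<otimes> a [^] n = \<zero>\<close> reads \<open>y = \<zero>\<close>.\<close>
    moreover have "y \<otimes> a = \<zero>" if "y = \<zero>" using that ac by simp
    ultimately show "a \<in> Ann A y" using ac yc by (cases n) (auto simp: Ann_def)
  qed
  then show ?thesis using yP yc by blast
qed

end

theorem theorem4p1:
  fixes A :: "('a, 'm) ring_scheme"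
  assumes "b1_algebra A"
    and "weakly_noetherian A"
    and "associated_ideal A P"
  shows "(\<exists>u\<in>carrier A - {\<zero>\<^bsub>A\<^esub>}. P = Ann A u) \<and> saturated_ideal A P"
proof -
  interpret b1_algebra A by fact
  obtain x where x: "x \<in> carrier A" "associated_to A x P"
    using assms(3) by (auto simp: associated_ideal_def)
  have P: "prime_b1_ideal A P" using associated_ideal_prime assms(3) .
  obtain u where u: "u \<in> carrier A" "P = Ann A u"
    using prime_eq_Ann[OF assms(2) P x(1)] associated_to_annihilated[OF x] by blast
  \<comment> \<open>The annihilator of zero is the whole carrier, whereas a prime ideal is
    proper.\<close>
  moreover have "u \<noteq> \<zero>\<^bsub>A\<^esub>"
    using P u by (auto simp: prime_b1_ideal_def Ann_def)
  ultimately show ?thesis using Ann_saturated by blast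
qed

end
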